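(* Let $G=(V,E)$ be a finite bipartite graph such that $\tau(G,x)\geq(1-x^2)^{|E|}$ holds for every $x\in(-1,1)$. Then every homogeneous Gaussian Markov random field $\{X_v\}_{v\in V}$ on $G$ satisfies $$\mathbb{D}(\{X_v\}_{v\in V})-\sum_{(i,j)\in E}\mathbb{D}(\{X_i,X_j\})+\sum_{v\in V}(\deg(v)-1)\,\mathbb{D}(X_v)\geq 0.$$
   Context: Graphs are finite and simple; the sum over $(i,j)\in E$ counts each (undirected) edge once. For a finite graph $G=(V,E)$ and $x\in(-1,1)$, $\Psi(G,x)$ is the set of real $V\times V$ matrices $M$ such that (1) $M$ is (symmetric) positive definite, (2) every diagonal entry of $M$ is $1$, (3) $M_{i,j}=x$ for every edge $(i,j)$ of $G$. When $\Psi(G,x)$ is nonempty (which is always the case for bipartite $G$), there is a unique matrix $\Sigma(G,x)\in\Psi(G,x)$ maximizing the determinant on $\Psi(G,x)$, and $\tau(G,x):=\det(\Sigma(G,x))$. A Gaussian Markov random field (GMRF) on $G$ is a jointly Gaussian family $\{X_v\}_{v\in V}$ of real random variables with nondegenerate (positive definite) covariance matrix $\Sigma$ that is Markov with respect to $G$, i.e. $(\Sigma^{-1})_{i,j}=0$ for all distinct non-adjacent $i,j\in V$. It is called homogeneous if the marginal distributions on the edges are all identical, i.e. the law of $(X_i,X_j)$ is the same for all ordered pairs $(i,j)$ of adjacent vertices. $\mathbb{D}(\{X_i\}_{i\in I})$ denotes the differential entropy of the joint distribution of $\{X_i\}_{i\in I}$ (with natural logarithm), i.e. $-\int f\ln f$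 where $f$ is the joint density. *)

theory Defs
  imports "HOL-Probability.Probability"
begin

text \<open>A finite simple graph is given by its set of edges, which are two-element sets of
  vertices; its vertex set is the whole finite type.\<close>

definition simple_graph :: "'v::finite set set \<Rightarrow> bool" where
  "simple_graph E \<longleftrightarrow> (\<forall>e\<in>E. card e = 2)"

definition bipartite :: "'v::finite set set \<Rightarrow> bool" where
  "bipartite E \<longleftrightarrow> (\<exists>A. \<forall>i j. {i, j} \<in> E \<longrightarrow> (i \<in> A) \<noteq> (j \<in> A))"

definition vertex_degree :: "'v::finite set set \<Rightarrow> 'v \<Rightarrow> nat" where
  "vertex_degree E v = card {e \<in> E. v \<in> e}"

definition pos_definite :: "real^'n^'n \<Rightarrow> bool" where
  "pos_definite A \<longleftrightarrow> transpose A = A \<and> (\<forall>y. y \<noteq> 0 \<longrightarrow> y \<bullet> (A *v y) > 0)"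

definition Psi :: "'v::finite set set \<Rightarrow> real \<Rightarrow> (real^'v^'v) set" where
  "Psi E x = {A. pos_definite A \<and> (\<forall>i. A $ i $ i = 1) \<and> (\<forall>i j. {i, j} \<in> E \<longrightarrow> A $ i $ j = x)}"

text \<open>\<open>Sigma_max\<close> and \<open>tau\<close> are meaningful only where \<open>Psi E x\<close> is nonempty, in particular for
  bipartite graphs and \<open>-1 < x < 1\<close>; the maximizer is then unique.\<close>

definition Sigma_max :: "'v::finite set set \<Rightarrow> real \<Rightarrow> real^'v^'v" where
  "Sigma_max E x = arg_max_on det (Psi E x)"

definition tau :: "'v::finite set set \<Rightarrow> real \<Rightarrow> real" where
  "tau E x = det (Sigma_max E x)"

definition mean_vector :: "'w measure \<Rightarrow> ('v::finite \<Rightarrow> 'w \<Rightarrow> real) \<Rightarrow> real^'v" where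
  "mean_vector M X = (\<chi> i. \<integral>\<omega>. X i \<omega> \<partial>M)"

definition cov_matrix :: "'w measure \<Rightarrow> ('v::finite \<Rightarrow> 'w \<Rightarrow> real) \<Rightarrow> real^'v^'v" where
  "cov_matrix M X =
     (\<chi> i j. \<integral>\<omega>. (X i \<omega> - mean_vector M X $ i) * (X j \<omega> - mean_vector M X $ j) \<partial>M)"

definition gaussian_density :: "real^'v \<Rightarrow> real^'v^'v \<Rightarrow> ('v::finite \<Rightarrow> real) \<Rightarrow> real" where
  "gaussian_density \<mu> S x =
     exp (- (((\<chi> v. x v) - \<mu>) \<bullet> (matrix_inv S *v ((\<chi> v. x v) - \<mu>))) / 2)
       / sqrt ((2 * pi) ^ CARD('v) * det S)"

definition joint_var :: "('v \<Rightarrow> 'w \<Rightarrow> real) \<Rightarrow> 'v set \<Rightarrow> 'w \<Rightarrow> 'v \<Rightarrow> real" where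
  "joint_var X I = (\<lambda>\<omega>. \<lambda>i\<in>I. X i \<omega>)"

text \<open>A nondegenerate Gaussian law has a density determined by its mean and covariance; here these
  parameters are the actual mean and covariance of the family.\<close>

definition gaussian_family :: "'w measure \<Rightarrow> ('v::finite \<Rightarrow> 'w \<Rightarrow> real) \<Rightarrow> bool" where
  "gaussian_family M X \<longleftrightarrow>
     prob_space M \<and> pos_definite (cov_matrix M X) \<and>
     distributed M (Pi\<^sub>M UNIV (\<lambda>_. lborel)) (joint_var X UNIV)
       (\<lambda>x. ennreal (gaussian_density (mean_vector M X) (cov_matrix M X) x))"

definition GMRF :: "'v::finite set set \<Rightarrow> 'w measure \<Rightarrow> ('v \<Rightarrow> 'w \<Rightarrow> real) \<Rightarrow> bool" where
  "GMRF E M X \<longleftrightarrow> gaussian_family M X \<and>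
     (\<forall>i j. i \<noteq> j \<longrightarrow> {i, j} \<notin> E \<longrightarrow> matrix_inv (cov_matrix M X) $ i $ j = 0)"

definition homogeneous :: "'v::finite set set \<Rightarrow> 'w measure \<Rightarrow> ('v \<Rightarrow> 'w \<Rightarrow> real) \<Rightarrow> bool" where
  "homogeneous E M X \<longleftrightarrow>
     (\<forall>i j k l. {i, j} \<in> E \<longrightarrow> {k, l} \<in> E \<longrightarrow>
        distr M (borel \<Otimes>\<^sub>M borel) (\<lambda>\<omega>. (X i \<omega>, X j \<omega>)) =
        distr M (borel \<Otimes>\<^sub>M borel) (\<lambda>\<omega>. (X k \<omega>, X l \<omega>)))"

text \<open>Relative to Lebesgue measure the library's entropy is differential entropy
  (see \<open>entropy_distr\<close>); base \<open>exp 1\<close> gives the natural logarithm.\<close>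

definition diff_entropy :: "'w measure \<Rightarrow> ('v \<Rightarrow> 'w \<Rightarrow> real) \<Rightarrow> 'v set \<Rightarrow> real" where
  "diff_entropy M X I = prob_space.entropy M (exp 1) (Pi\<^sub>M I (\<lambda>_. lborel)) (joint_var X I)"

end

theory Submission
  imports Defs
begin

text \<open>
  Let \<open>S\<close> be the covariance matrix of the field and \<open>n\<close> the number of vertices. The entropy
  combination is computed exactly. A Gaussian vector with density \<open>C * exp (- q / 2)\<close>, where \<open>q\<close> is
  the quadratic form of the inverse covariance, has entropy \<open>dim / 2 - ln C\<close>, because the
  expectation of \<open>q\<close> is the trace of the identity (\<open>gaussian_on_entropy\<close>). Marginals are again of
  this form: integrating out one coordinate means completing a square, and on the coefficients this
  is one step of Gaussian elimination (\<open>gaussian_on_eliminate\<close>), which leaves the inverse of the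
  remaining submatrix of \<open>S\<close> (\<open>inverse_on_eliminate\<close>). Integrating out all coordinates leaves total mass \<open>1\<close>,
  which fixes the constants \<open>C\<close> for single vertices and for edges.

  Homogeneity makes the correlation along edges a constant \<open>x\<close>, so that the entropy of an edge is the
  sum of the entropies of its two ends plus \<open>ln (1 - x\<^sup>2) / 2\<close>. Counting every vertex once for each
  incident edge, the degree terms cancel, and twice the combination equals
  \<open>ln (det S) - (\<Sum>v. ln (S $ v $ v)) - card E * ln (1 - x\<^sup>2)\<close>.
  The first two terms are the logarithm of the determinant of the correlation matrix \<open>R\<close>, so the
  claim becomes \<open>det R \<ge> (1 - x\<^sup>2) ^ card E\<close>.

  It remains to see that \<open>det R = tau E x\<close>, that is, that \<open>R\<close> maximizes the determinant on \<open>Psi E x\<close>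
  (\<open>tau_eq_det\<close>). The inverse of \<open>R\<close> vanishes off the diagonal and the edges, which is exactly where
  the entries of a competitor \<open>N\<close> may differ from those of \<open>R\<close>; hence the inverse of \<open>R\<close> times \<open>N\<close>
  has trace \<open>n\<close>, and \<open>det N \<le> det R\<close> follows from the matrix form of \<open>ln z \<le> z - 1\<close>
  (\<open>det_mult_le_exp_trace\<close>), which in turn rests on Hadamard's inequality.
\<close>

section \<open>Determinants of positive definite matrices\<close>

lemma inner_congruence:
  fixes A L :: "real^'n^'n"
  shows "y \<bullet> ((L ** A ** transpose L) *v y) = (transpose L *v y) \<bullet> (A *v (transpose L *v y))"
  by (metis dot_lmul_matrix matrix_vector_mul_assoc transpose_matrix_vector vector_transpose_matrix)

lemma pos_definite_congruence:
  fixes A L :: "real^'n^'n"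
  assumes "pos_definite A" "det L \<noteq> 0"
  shows "pos_definite (L ** A ** transpose L)"
  unfolding pos_definite_def
proof (intro conjI allI impI)
  show "transpose (L ** A ** transpose L) = L ** A ** transpose L"
    using assms(1) by (simp add: pos_definite_def matrix_transpose_mul matrix_mul_assoc)
  fix y :: "real^'n" assume "y \<noteq> 0"
  have "det (transpose L) \<noteq> 0" using assms(2) by simp
  then obtain R where "R ** transpose L = mat 1"
    by (metis invertible_def invertible_det_nz)
  then have "transpose L *v y \<noteq> 0"
    using \<open>y \<noteq> 0\<close>
    by (metis matrix_vector_mul_assoc matrix_vector_mul_lid matrix_vector_mult_0_right)
  then show "0 < y \<bullet> ((L ** A ** transpose L) *v y)"
    using assms(1) by (simp add: inner_congruence pos_definite_def)
qed

lemma pos_definite_sym: "pos_definite A \<Longrightarrow> A $ i $ j = A $ j $ i"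
  unfolding pos_definite_def by (metis transpose_def vec_lambda_beta)

lemma pos_definite_diag_pos:
  assumes "pos_definite A"
  shows "A $ i $ i > 0"
proof -
  have "axis i 1 \<bullet> (A *v axis i 1) > 0"
    using assms by (simp add: pos_definite_def axis_eq_0_iff)
  then show ?thesis by (simp add: matrix_vector_mult_basis inner_axis' column_def)
qed

text \<open>Symmetric Gaussian elimination. The transformation has determinant \<open>1\<close>, so \<open>D\<close> carries the
  determinant of \<open>A\<close> on its diagonal. Each step subtracts a square over a positive pivot from the
  diagonal entries, which is why they do not grow; the bound on them is what yields Hadamard's
  inequality.\<close>

lemma pos_definite_diagonalize:
  fixes A :: "real^'n^'n"
  assumes "pos_definite A"
  obtains L D where "det L = 1" "D = L ** A ** transpose L" "\<And>i j. i \<noteq> j \<Longrightarrow> D $ i $ j = 0"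
    "\<And>i. D $ i $ i \<le> A $ i $ i"
proof -
  have "\<exists>L D. det L = 1 \<and> D = L ** A ** transpose L \<and> (\<forall>i j. i \<in> I \<longrightarrow> i \<noteq> j \<longrightarrow> D $ i $ j = 0)
     \<and> (\<forall>i. D $ i $ i \<le> A $ i $ i)" if "finite I" for I
    using that
  proof (induction I)
    case empty
    then show ?case by (intro exI[of _ "mat 1"] exI[of _ A]) simp
  next
    case (insert k I)
    then obtain L D where L: "det L = 1" and D: "D = L ** A ** transpose L"
      and off: "\<And>i j. i \<in> I \<Longrightarrow> i \<noteq> j \<Longrightarrow> D $ i $ j = 0" and le: "\<And>i. D $ i $ i \<le> A $ i $ i"
      by blast
    have pd: "pos_definite D" unfolding D using assms L by (intro pos_definite_congruence) auto
    have kk: "D $ k $ k > 0" by (rule pos_definite_diag_pos[OF pd])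
    have sym: "D $ i $ j = D $ j $ i" for i j by (rule pos_definite_sym[OF pd])
    (* F adds the multiple y i of row k to row i, which clears column k. It is the identity with
       column k replaced, so its determinant comes from Cramer's rule. *)
    define y where "y i = (if i = k then 0 else - D $ i $ k / D $ k $ k)" for i
    define F :: "real^'n^'n" where
      "F = (\<chi> i a. if a = k then (mat 1 *v (\<chi> i. if i = k then 1 else y i)) $ i else mat 1 $ i $ a)"
    have detF: "det F = 1" unfolding F_def cramer_lemma by simp
    have F: "F $ i $ a = (if i = a then 1 else 0) + (if a = k then y i else 0)" for i a
      by (auto simp: F_def mat_def matrix_vector_mult_def y_def if_distrib[of "\<lambda>x. x * _"] cong: if_cong)
    have FD: "(F ** D) $ i $ b = D $ i $ b + y i * D $ k $ b" for i b
      by (simp add: matrix_matrix_mult_def F distrib_right sum.distrib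
          if_distrib[of "\<lambda>x. x * _"] cong: if_cong)
    have B: "(F ** D ** transpose F) $ i $ j
        = D $ i $ j + y i * D $ k $ j + y j * (D $ i $ k + y i * D $ k $ k)" for i j
      unfolding matrix_matrix_mult_def[of "F ** D"]
      by (simp add: FD transpose_def F distrib_left sum.distrib
          if_distrib[of "\<lambda>x. _ * x"] if_distrib[of "\<lambda>x. x * _"] cong: if_cong)
        (simp add: algebra_simps)
    define B where "B = F ** D ** transpose F"
    have "det (F ** L) = 1" by (simp add: det_mul detF L)
    moreover have "B = (F ** L) ** A ** transpose (F ** L)"
      by (simp add: B_def D matrix_transpose_mul matrix_mul_assoc)
    moreover have "B $ i $ j = 0" if "i \<in> insert k I" "i \<noteq> j" for i j
    proof (cases "i = k")
      case True
      with that kk show ?thesis unfolding B_def B by (simp add: y_def sym[of k j])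
    next
      case False
      with that off[of i] have "i \<in> I" "D $ i $ j = 0" "D $ i $ k = 0" by auto
      with False show ?thesis unfolding B_def B by (simp add: y_def)
    qed
    moreover have "B $ i $ i \<le> A $ i $ i" for i
    proof -
      have "B $ i $ i \<le> D $ i $ i"
      proof (cases "i = k")
        case False
        then have "B $ i $ i = D $ i $ i - (D $ i $ k)\<^sup>2 / D $ k $ k"
          unfolding B_def B using kk by (simp add: y_def sym[of k i] power2_eq_square field_simps)
        with kk show ?thesis by simp
      qed (simp add: B_def B y_def)
      with le[of i] show ?thesis by linarith
    qed
    ultimately show ?case by blast
  qed
  from this[of UNIV] that show thesis by auto
qed

lemma pos_definite_det_pos:
  fixes A :: "real^'n^'n"
  assumes "pos_definite A"
  shows "det A > 0"
proof -
  obtain L D where L: "det L = 1" "D = L ** A ** transpose L" "\<And>i j. i \<noteq> j \<Longrightarrow> D $ i $ j = 0"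
    using pos_definite_diagonalize[OF assms] by metis
  have "pos_definite D" unfolding L(2) using assms L(1) by (intro pos_definite_congruence) auto
  then have "det D > 0"
    using L(3) by (simp add: det_diagonal pos_definite_diag_pos prod_pos)
  with L show ?thesis by (simp add: det_mul)
qed

lemma hadamard_inequality:
  fixes A :: "real^'n^'n"
  assumes "pos_definite A"
  shows "det A \<le> (\<Prod>i\<in>UNIV. A $ i $ i)"
proof -
  obtain L D where L: "det L = 1" "D = L ** A ** transpose L" "\<And>i j. i \<noteq> j \<Longrightarrow> D $ i $ j = 0"
    and le: "\<And>i. D $ i $ i \<le> A $ i $ i"
    using pos_definite_diagonalize[OF assms] by metis
  have "pos_definite D" unfolding L(2) using assms L(1) by (intro pos_definite_congruence) auto
  then have pos: "D $ i $ i > 0" for i by (rule pos_definite_diag_pos)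
  have "det A = det D" using L by (simp add: det_mul)
  also have "\<dots> = (\<Prod>i\<in>UNIV. D $ i $ i)" using L(3) by (rule det_diagonal)
  also have "\<dots> \<le> (\<Prod>i\<in>UNIV. A $ i $ i)" using pos le by (intro prod_mono) (auto intro: less_imp_le)
  finally show ?thesis .
qed

text \<open>In terms of the eigenvalues \<open>z\<close> of \<open>K ** N\<close> this would be \<open>\<Prod> z \<le> exp (\<Sum> (z - 1))\<close>. Eigenvalues are
  avoided by changing coordinates so that \<open>N\<close> becomes diagonal and \<open>K\<close> becomes \<open>H\<close>: the trace then only
  sees the diagonal of \<open>H\<close>, and Hadamard's inequality bounds \<open>det H\<close> by the product of that diagonal.\<close>

lemma det_mult_le_exp_trace:
  fixes K N :: "real^'n^'n"
  assumes K: "pos_definite K" and N: "pos_definite N"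
  shows "det K * det N \<le> exp (trace (K ** N) - real CARD('n))"
proof -
  obtain L D where L: "det L = 1" and D: "D = L ** N ** transpose L"
    and diag: "\<And>i j. i \<noteq> j \<Longrightarrow> D $ i $ j = 0"
    using pos_definite_diagonalize[OF N] by metis
  have pdD: "pos_definite D" unfolding D using N L by (intro pos_definite_congruence) auto
  have "det L \<noteq> 0" using L by simp
  then obtain R where R: "R ** L = mat 1" "L ** R = mat 1"
    by (metis invertible_def invertible_det_nz)
  have "det (R ** L) = 1" using R(1) by simp
  then have detR: "det R = 1" using L by (simp add: det_mul)
  define H where "H = transpose R ** K ** R"
  have pdH: "pos_definite H"
    using pos_definite_congruence[OF K, of "transpose R"] detR by (simp add: H_def)
  have tr: "transpose L ** transpose R = mat 1"
    using R(1) by (simp flip: matrix_transpose_mul)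
  have "H ** D = transpose R ** (K ** (R ** L) ** N ** transpose L)"
    by (simp add: H_def D matrix_mul_assoc)
  also have "\<dots> = transpose R ** (K ** N ** transpose L)" by (simp add: R)
  finally have "trace (H ** D) = trace (K ** N ** transpose L ** transpose R)"
    by (metis trace_mul_sym)
  also have "\<dots> = trace (K ** N)" by (metis matrix_mul_assoc matrix_mul_rid tr)
  finally have trace: "trace (K ** N) = (\<Sum>i\<in>UNIV. \<Sum>j\<in>UNIV. H $ i $ j * D $ j $ i)"
    by (simp add: trace_def matrix_matrix_mult_def)
  have "(\<Sum>j\<in>UNIV. H $ i $ j * D $ j $ i) = H $ i $ i * D $ i $ i" for i
    by (subst sum.remove[of _ i]) (auto simp: diag intro!: sum.neutral)
  with trace have trace: "trace (K ** N) = (\<Sum>i\<in>UNIV. H $ i $ i * D $ i $ i)" by simp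
  have pos: "H $ i $ i > 0" "D $ i $ i > 0" for i
    using pdH pdD by (auto intro: pos_definite_diag_pos)
  have "det K * det N = det H * det D" by (simp add: H_def D det_mul L detR)
  also have "\<dots> \<le> (\<Prod>i\<in>UNIV. H $ i $ i) * (\<Prod>i\<in>UNIV. D $ i $ i)"
    using hadamard_inequality[OF pdH] diag pos
    by (simp add: det_diagonal prod_pos mult_right_mono less_imp_le)
  also have "\<dots> = (\<Prod>i\<in>UNIV. H $ i $ i * D $ i $ i)" by (simp add: prod.distrib)
  also have "\<dots> \<le> (\<Prod>i\<in>(UNIV::'n set). exp (H $ i $ i * D $ i $ i - 1))"
    using pos by (intro prod_mono) (auto intro: less_imp_le order_trans[OF _ exp_ge_add_one_self])
  also have "\<dots> = exp (trace (K ** N) - real CARD('n))"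
    by (simp add: trace exp_sum[symmetric] sum_subtractf)
  finally show ?thesis .
qed

lemma det_scale:
  fixes A :: "real^'n^'n"
  shows "det (\<chi> i j. s i * s j * A $ i $ j) = (\<Prod>i\<in>UNIV. s i)\<^sup>2 * det A"
proof -
  define S :: "real^'n^'n" where "S = (\<chi> i j. if i = j then s i else 0)"
  have "(\<chi> i j. s i * s j * A $ i $ j) = S ** A ** S"
    by (simp add: S_def matrix_matrix_mult_def vec_eq_iff if_distrib[of "\<lambda>x. x * _"]
        if_distrib[of "\<lambda>x. _ * x"] cong: if_cong)
  moreover have "det S = (\<Prod>i\<in>UNIV. s i)"
    by (subst det_diagonal) (auto simp: S_def)
  ultimately show ?thesis by (simp add: det_mul power2_eq_square)
qed

lemma pos_definite_scale:
  fixes A :: "real^'n^'n"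
  assumes A: "pos_definite A" and s: "\<And>i. s i \<noteq> 0"
  shows "pos_definite (\<chi> i j. s i * s j * A $ i $ j)"
proof -
  define S :: "real^'n^'n" where "S = (\<chi> i j. if i = j then s i else 0)"
  have "(\<chi> i j. s i * s j * A $ i $ j) = S ** A ** transpose S"
    by (simp add: S_def matrix_matrix_mult_def transpose_def vec_eq_iff if_distrib[of "\<lambda>x. x * _"]
        if_distrib[of "\<lambda>x. _ * x"] cong: if_cong)
  moreover have "det S = (\<Prod>i\<in>UNIV. s i)"
    by (subst det_diagonal) (auto simp: S_def)
  ultimately show ?thesis using pos_definite_congruence[OF A, of S] s by simp
qed

lemma pos_definite_inverse:
  fixes A :: "real^'n^'n"
  assumes A: "pos_definite A"
  shows "A ** matrix_inv A = mat 1" "matrix_inv A ** A = mat 1" "pos_definite (matrix_inv A)"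
proof -
  have "invertible A" using pos_definite_det_pos[OF A] by (simp add: invertible_det_nz)
  then show 1: "A ** matrix_inv A = mat 1" and 2: "matrix_inv A ** A = mat 1"
    unfolding invertible_def matrix_inv_def by (metis (mono_tags, lifting) someI_ex)+
  let ?K = "matrix_inv A"
  have "transpose A = A" using A by (simp add: pos_definite_def)
  then have sym: "transpose ?K = ?K"
    by (metis 1 2 matrix_mul_assoc matrix_mul_lid matrix_mul_rid matrix_transpose_mul transpose_mat)
  have "det A * det ?K = 1" using 1 by (metis det_I det_mul)
  then have "pos_definite (?K ** A ** transpose ?K)"
    by (intro pos_definite_congruence A) auto
  then show "pos_definite ?K" by (simp add: 2 sym)
qed

section \<open>The maximal determinant\<close>

text \<open>The product of the variances converts between covariance and correlation matrices. The Markov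
  property is the stationarity condition of the concave problem of maximizing the logarithm of the
  determinant on \<open>Psi E x\<close>; the trace inequality shows directly that it is sufficient for a maximum.\<close>

lemma tau_eq_det:
  fixes S :: "real^'v^'v"
  assumes S: "pos_definite S"
    and markov: "\<And>i j. i \<noteq> j \<Longrightarrow> {i, j} \<notin> E \<Longrightarrow> matrix_inv S $ i $ j = 0"
    and edge: "\<And>i j. {i, j} \<in> E \<Longrightarrow> S $ i $ j = x * sqrt (S $ i $ i) * sqrt (S $ j $ j)"
  shows "tau E x * (\<Prod>i\<in>UNIV. S $ i $ i) = det S"
proof -
  define s where "s i = sqrt (S $ i $ i)" for i
  have diag: "S $ i $ i > 0" for i by (rule pos_definite_diag_pos[OF S])
  have s: "s i > 0" "s i * s i = S $ i $ i" for i using diag[of i] by (simp_all add: s_def)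
  have s0: "s i \<noteq> 0" for i using s(1)[of i] by simp
  have s2: "(\<Prod>i\<in>UNIV. s i)\<^sup>2 = (\<Prod>i\<in>UNIV. S $ i $ i)"
    by (simp add: power2_eq_square s(2) flip: prod.distrib)
  have diag_prod: "(\<Prod>i\<in>UNIV. S $ i $ i) > 0" by (intro prod_pos) (simp add: diag)
  define R :: "real^'v^'v" where "R = (\<chi> i j. inverse (s i) * inverse (s j) * S $ i $ j)"
  have "R \<in> Psi E x"
    unfolding Psi_def
  proof (intro CollectI conjI allI impI)
    show "pos_definite R" unfolding R_def
      using s0 by (intro pos_definite_scale S) simp
    show "R $ i $ i = 1" for i
      using s(1)[of i] by (simp add: R_def field_simps flip: s(2))
    show "R $ i $ j = x" if "{i, j} \<in> E" for i j
      using s(1)[of i] s(1)[of j] by (simp add: R_def edge[OF that] field_simps flip: s_def)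
  qed
  have "(\<Prod>i\<in>UNIV. inverse (s i))\<^sup>2 * (\<Prod>i\<in>UNIV. S $ i $ i) = 1"
    using diag_prod by (simp add: s2[symmetric] prod_inversef[unfolded comp_def] power_inverse)
  then have detR: "det R * (\<Prod>i\<in>UNIV. S $ i $ i) = det S"
    unfolding R_def det_scale by (metis mult.commute mult.left_commute mult.right_neutral)
  have max: "det N \<le> det R" if N: "N \<in> Psi E x" for N
  proof -
    let ?K = "matrix_inv S"
    define N' :: "real^'v^'v" where "N' = (\<chi> i j. s i * s j * N $ i $ j)"
    have pdN: "pos_definite N" using N by (simp add: Psi_def)
    then have "pos_definite N'"
      unfolding N'_def using s0 by (intro pos_definite_scale)
    (* N' has the same entries as S on the diagonal and on edges; elsewhere the inverse vanishes. *)
    have agree: "?K $ i $ j * N' $ j $ i = ?K $ i $ j * S $ j $ i" for i j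
    proof -
      consider "i = j" | "i \<noteq> j" "{i, j} \<notin> E" | "{i, j} \<in> E" by blast
      then show ?thesis
      proof cases
        case 1
        then show ?thesis using N by (simp add: N'_def Psi_def s(2))
      next
        case 2
        then show ?thesis by (simp add: markov)
      next
        case 3
        then have ji: "{j, i} \<in> E" by (simp add: insert_commute)
        then have "N $ j $ i = x" using N by (simp add: Psi_def)
        then show ?thesis using edge[OF ji] by (simp add: N'_def s_def)
      qed
    qed
    have "trace (?K ** N') = trace (?K ** S)"
      by (simp add: trace_def matrix_matrix_mult_def agree)
    also have "\<dots> = real CARD('v)" by (simp add: pos_definite_inverse(2)[OF S] trace_I)
    finally have "det ?K * det N' \<le> 1"
      using det_mult_le_exp_trace[OF pos_definite_inverse(3)[OF S] \<open>pos_definite N'\<close>] by simp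
    moreover have "det ?K * det S = 1"
      by (metis det_I det_mul pos_definite_inverse(2)[OF S])
    ultimately have "det ?K * det N' \<le> det ?K * det S" by simp
    moreover have "det ?K > 0" by (intro pos_definite_det_pos pos_definite_inverse(3) S)
    ultimately have "det N' \<le> det S" by simp
    then have "det N * (\<Prod>i\<in>UNIV. S $ i $ i) \<le> det R * (\<Prod>i\<in>UNIV. S $ i $ i)"
      unfolding detR N'_def det_scale s2 by (simp add: mult.commute)
    then show ?thesis using diag_prod by simp
  qed
  have "tau E x = det R"
    unfolding tau_def Sigma_max_def arg_max_on_def
    using \<open>R \<in> Psi E x\<close> max by (intro arg_max_equality) auto
  then show ?thesis by (simp add: detR)
qed

section \<open>Marginals of Gaussian densities\<close>

text \<open>A marginal on \<open>I\<close> is described by a coefficient function \<open>A\<close> on all pairs of vertices of which the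
  density involves only the block \<open>I \<times> I\<close>, so that \<open>I\<close> can shrink without a change of type.\<close>

definition quad_form :: "('v \<Rightarrow> 'v \<Rightarrow> real) \<Rightarrow> 'v set \<Rightarrow> ('v \<Rightarrow> real) \<Rightarrow> real" where
  "quad_form A I z = (\<Sum>i\<in>I. \<Sum>j\<in>I. A i j * z i * z j)"

definition inverse_on :: "'v::finite set \<Rightarrow> ('v \<Rightarrow> 'v \<Rightarrow> real) \<Rightarrow> real^'v^'v \<Rightarrow> bool" where
  "inverse_on I A S \<longleftrightarrow> (\<forall>i j. A i j = A j i) \<and>
     (\<forall>i\<in>I. \<forall>l\<in>I. (\<Sum>j\<in>I. A i j * S $ j $ l) = (if i = l then 1 else 0))"

text \<open>The Schur complement of the entry at \<open>k\<close>.\<close>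

definition eliminate :: "'v \<Rightarrow> ('v \<Rightarrow> 'v \<Rightarrow> real) \<Rightarrow> 'v \<Rightarrow> 'v \<Rightarrow> real" where
  "eliminate k A i j = A i j - A i k * A k j / A k k"

text \<open>Positivity of the pivots comes from the fixed matrix \<open>S\<close>, through \<open>A k k = y \<bullet> (S *v y)\<close> for the row \<open>y\<close> of
  \<open>A\<close> at \<open>k\<close>, extended by \<open>0\<close> outside \<open>I\<close>, so definiteness of the shrinking block \<open>A\<close> need not be carried along.\<close>

lemma inverse_on_diag_pos:
  assumes S: "pos_definite S" and A: "inverse_on I A S" and k: "k \<in> I"
  shows "A k k > 0"
proof -
  have inv: "(\<Sum>j\<in>I. A k j * S $ j $ l) = (if k = l then 1 else 0)" if "l \<in> I" for l
    using A k that unfolding inverse_on_def by blast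
  define y where "y = (\<chi> j. if j \<in> I then A k j else 0)"
  have "y \<noteq> 0"
  proof
    assume "y = 0"
    then have "A k j = 0" if "j \<in> I" for j
      using that by (auto simp: y_def vec_eq_iff split: if_splits)
    with inv[OF k] show False by simp
  qed
  then have "0 < y \<bullet> (S *v y)" using S by (simp add: pos_definite_def)
  also have "y \<bullet> (S *v y) = (\<Sum>i\<in>UNIV. \<Sum>l\<in>UNIV. y $ i * S $ i $ l * y $ l)"
    by (simp add: inner_vec_def matrix_vector_mult_def sum_distrib_left mult.assoc)
  also have "\<dots> = (\<Sum>i\<in>I. \<Sum>l\<in>I. A k i * S $ i $ l * A k l)"
    by (intro sum.mono_neutral_cong_right ballI sum.neutral) (auto simp: y_def intro!: sum.mono_neutral_cong_right)
  also have "\<dots> = (\<Sum>l\<in>I. (\<Sum>i\<in>I. A k i * S $ i $ l) * A k l)"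
    by (subst sum.swap) (simp add: sum_distrib_right)
  also have "\<dots> = A k k" using k by (simp add: inv if_distrib[of "\<lambda>x. x * _"] cong: if_cong)
  finally show ?thesis .
qed

text \<open>The familiar fact that the inverse of a principal submatrix of \<open>S\<close> is the Schur complement in the
  inverse of \<open>S\<close>. It is what keeps the covariance matrix of every marginal a submatrix of the original
  one.\<close>

lemma inverse_on_eliminate:
  assumes A: "inverse_on (insert k I) A S" and k: "k \<notin> I" and nz: "A k k \<noteq> 0"
  shows "inverse_on I (eliminate k A) S"
proof -
  have sym: "A i j = A j i" for i j using A by (simp add: inverse_on_def)
  have inv: "(\<Sum>j\<in>I. A i j * S $ j $ l) = (if i = l then 1 else 0) - A i k * S $ k $ l"
    if "i \<in> insert k I" "l \<in> insert k I" for i l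
  proof -
    have "(\<Sum>j\<in>insert k I. A i j * S $ j $ l) = (if i = l then 1 else 0)"
      using A that unfolding inverse_on_def by blast
    then show ?thesis using k by simp
  qed
  have "(\<Sum>j\<in>I. eliminate k A i j * S $ j $ l) = (if i = l then 1 else 0)"
    if "i \<in> I" "l \<in> I" for i l
  proof -
    have "(\<Sum>j\<in>I. eliminate k A i j * S $ j $ l)
       = (\<Sum>j\<in>I. A i j * S $ j $ l) - A i k / A k k * (\<Sum>j\<in>I. A k j * S $ j $ l)"
      by (simp add: eliminate_def left_diff_distrib sum_subtractf sum_distrib_left mult.assoc)
    also have "\<dots> = (if i = l then 1 else 0)"
      using that k nz by (auto simp: inv)
    finally show ?thesis .
  qed
  then show ?thesis by (auto simp: inverse_on_def eliminate_def sym mult.commute)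
qed

text \<open>Completing the square in the coordinate \<open>k\<close>.\<close>

lemma quad_form_insert:
  assumes "finite I" "k \<notin> I" "\<And>i j. A i j = A j i" "A k k \<noteq> 0"
  shows "quad_form A (insert k I) z
    = A k k * (z k + (\<Sum>j\<in>I. A k j * z j) / A k k)\<^sup>2 + quad_form (eliminate k A) I z"
proof -
  define b where "b = (\<Sum>j\<in>I. A k j * z j)"
  have "(\<Sum>i\<in>I. \<Sum>j\<in>I. A i k * A k j / A k k * z i * z j) = b * b / A k k"
    unfolding b_def sum_product sum_divide_distrib
  proof (intro sum.cong refl)
    fix i j
    show "A i k * A k j / A k k * z i * z j = A k i * z i * (A k j * z j) / A k k"
      unfolding assms(3)[of i k] by simp
  qed
  then have "quad_form (eliminate k A) I z = quad_form A I z - b * b / A k k"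
    by (simp add: quad_form_def eliminate_def left_diff_distrib sum_subtractf)
  moreover have "(\<Sum>i\<in>I. A i k * z i * z k) = b * z k"
    unfolding b_def sum_distrib_right assms(3)[of _ k] ..
  then have "quad_form A (insert k I) z = A k k * z k * z k + 2 * z k * b + quad_form A I z"
    using assms(1,2)
    by (simp add: quad_form_def sum.distrib b_def sum_distrib_left algebra_simps)
  moreover have "A k k * (z k + b / A k k)\<^sup>2 = A k k * z k * z k + 2 * z k * b + b * b / A k k"
    using assms(4) by (simp add: power2_eq_square field_simps)
  ultimately show ?thesis
    unfolding b_def[symmetric] by linarith
qed

lemma nn_integral_gaussian:
  assumes "a > 0"
  shows "(\<integral>\<^sup>+y. ennreal (exp (- (a * (y - m)\<^sup>2) / 2)) \<partial>lborel) = ennreal (sqrt (2 * pi / a))"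
proof -
  have "exp (- (a * (y - m)\<^sup>2) / 2) = sqrt (2 * pi / a) * normal_density m (1 / sqrt a) y" for y
    using assms by (simp add: normal_density_def real_sqrt_divide real_sqrt_mult power_divide mult.commute)
  then have "(\<integral>\<^sup>+y. ennreal (exp (- (a * (y - m)\<^sup>2) / 2)) \<partial>lborel)
      = ennreal (sqrt (2 * pi / a)) * (\<integral>\<^sup>+y. normal_density m (1 / sqrt a) y \<partial>lborel)"
    using assms by (subst nn_integral_cmult[symmetric]) (auto simp: ennreal_mult)
  also have "(\<integral>\<^sup>+y. normal_density m (1 / sqrt a) y \<partial>lborel) = 1"
    using assms by (subst nn_integral_eq_integral) auto
  finally show ?thesis by simp
qed

lemma borel_measurable_quad_form[measurable]:
  "(\<lambda>x. quad_form A I (\<lambda>i. x i - \<mu> i)) \<in> borel_measurable (\<Pi>\<^sub>M i\<in>I. lborel)"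
  unfolding quad_form_def by measurable

text \<open>The normalizing constant \<open>C\<close> is left open; it is determined afterwards by total mass.\<close>

definition gaussian_on ::
  "'w measure \<Rightarrow> ('v::finite \<Rightarrow> 'w \<Rightarrow> real) \<Rightarrow> ('v \<Rightarrow> real) \<Rightarrow> 'v set \<Rightarrow> ('v \<Rightarrow> 'v \<Rightarrow> real) \<Rightarrow> real \<Rightarrow> bool"
  where "gaussian_on M X \<mu> I A C \<longleftrightarrow> C > 0 \<and>
     distributed M (\<Pi>\<^sub>M i\<in>I. lborel) (joint_var X I)
       (\<lambda>x. ennreal (C * exp (- quad_form A I (\<lambda>i. x i - \<mu> i) / 2)))"

text \<open>After completing the square, the coordinate \<open>k\<close> contributes a one-dimensional Gaussian integral whose
  value does not depend on the other coordinates, because they only shift its centre.\<close>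

lemma gaussian_on_eliminate:
  fixes X :: "'v::finite \<Rightarrow> 'w \<Rightarrow> real"
  assumes G: "gaussian_on M X \<mu> (insert k I) A C" and k: "k \<notin> I"
    and sym: "\<And>i j. A i j = A j i" and pos: "A k k > 0"
  shows "gaussian_on M X \<mu> I (eliminate k A) (C * sqrt (2 * pi / A k k))"
proof -
  interpret product_sigma_finite "\<lambda>_::'v. lborel :: real measure"
    by standard
  let ?N = "\<lambda>I::'v set. \<Pi>\<^sub>M i\<in>I. (lborel :: real measure)"
  let ?f = "\<lambda>x. ennreal (C * exp (- quad_form A (insert k I) (\<lambda>i. x i - \<mu> i) / 2))"
  let ?g = "\<lambda>x. ennreal (C * sqrt (2 * pi / A k k) * exp (- quad_form (eliminate k A) I (\<lambda>i. x i - \<mu> i) / 2))"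
  have C: "C > 0" and D: "distributed M (?N (insert k I)) (joint_var X (insert k I)) ?f"
    using G by (auto simp: gaussian_on_def)
  have J: "joint_var X (insert k I) \<in> M \<rightarrow>\<^sub>M ?N (insert k I)"
    using D by (rule distributed_measurable)
  have res[measurable]: "(\<lambda>x. restrict x I) \<in> ?N (insert k I) \<rightarrow>\<^sub>M ?N I"
    by (rule measurable_restrict_subset) auto
  have eq: "joint_var X I = (\<lambda>x. restrict x I) \<circ> joint_var X (insert k I)"
    by (auto simp: joint_var_def fun_eq_iff restrict_def)
  have JI: "joint_var X I \<in> M \<rightarrow>\<^sub>M ?N I"
    unfolding eq using J res by (rule measurable_comp)
  have inner: "(\<integral>\<^sup>+y. ?f (x(k := y)) \<partial>lborel) = ?g x" for x
  proof -
    define m where "m = \<mu> k - (\<Sum>j\<in>I. A k j * (x j - \<mu> j)) / A k k"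
    have agree: "(\<Sum>j\<in>I. A k j * ((x(k := y)) j - \<mu> j)) = (\<Sum>j\<in>I. A k j * (x j - \<mu> j))"
      "quad_form (eliminate k A) I (\<lambda>i. (x(k := y)) i - \<mu> i)
        = quad_form (eliminate k A) I (\<lambda>i. x i - \<mu> i)" for y
      unfolding quad_form_def using k by (auto intro!: sum.cong)
    have "?f (x(k := y)) = ennreal (C * exp (- quad_form (eliminate k A) I (\<lambda>i. x i - \<mu> i) / 2))
        * ennreal (exp (- (A k k * (y - m)\<^sup>2) / 2))" for y
    proof -
      have "quad_form A (insert k I) (\<lambda>i. (x(k := y)) i - \<mu> i)
         = A k k * (y - m)\<^sup>2 + quad_form (eliminate k A) I (\<lambda>i. x i - \<mu> i)"
        using quad_form_insert[of I k A "\<lambda>i. (x(k := y)) i - \<mu> i", OF finite k sym less_imp_neq[OF pos, symmetric]]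
        unfolding agree by (simp add: m_def algebra_simps)
      then show ?thesis using C
        by (simp add: ennreal_mult[symmetric] exp_add[symmetric] add_divide_distrib)
    qed
    moreover have borel: "(\<lambda>y. ennreal (exp (- (A k k * (y - m)\<^sup>2) / 2))) \<in> borel_measurable lborel"
      by measurable
    ultimately have "(\<integral>\<^sup>+y. ?f (x(k := y)) \<partial>lborel)
        = ennreal (C * exp (- quad_form (eliminate k A) I (\<lambda>i. x i - \<mu> i) / 2)) * ennreal (sqrt (2 * pi / A k k))"
      unfolding nn_integral_gaussian[OF pos, symmetric, of m] by (simp only: nn_integral_cmult borel)
    also have "\<dots> = ?g x"
      using C pos by (subst ennreal_mult[symmetric]) (auto intro: arg_cong[where f=ennreal])
    finally show ?thesis .
  qed
  have "distr M (?N I) (joint_var X I) = density (?N I) ?g"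
  proof (rule measure_eqI)
    fix B assume "B \<in> sets (distr M (?N I) (joint_var X I))"
    then have B[measurable]: "B \<in> sets (?N I)" by simp
    have "emeasure (distr M (?N I) (joint_var X I)) B
        = emeasure M (joint_var X (insert k I) -` ((\<lambda>x. restrict x I) -` B \<inter> space (?N (insert k I))) \<inter> space M)"
      using JI B measurable_space[OF J] by (auto simp: emeasure_distr eq intro!: arg_cong[where f="emeasure M"])
    also have "\<dots> = (\<integral>\<^sup>+x. ?f x * indicator ((\<lambda>x. restrict x I) -` B \<inter> space (?N (insert k I))) x \<partial>?N (insert k I))"
      by (rule distributed_emeasure[OF D]) (rule measurable_sets[OF res B])
    also have "\<dots> = (\<integral>\<^sup>+x. ?f x * indicator B (restrict x I) \<partial>?N (insert k I))"
      by (intro nn_integral_cong) (auto split: split_indicator)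
    also have "\<dots> = (\<integral>\<^sup>+x. \<integral>\<^sup>+y. ?f (x(k := y)) * indicator B (restrict (x(k := y)) I) \<partial>lborel \<partial>?N I)"
      using k by (intro product_nn_integral_insert) auto
    also have "\<dots> = (\<integral>\<^sup>+x. \<integral>\<^sup>+y. ?f (x(k := y)) * indicator B x \<partial>lborel \<partial>?N I)"
    proof (intro nn_integral_cong)
      fix x y assume "x \<in> space (?N I)"
      then have "restrict (x(k := y)) I = x"
        using k by (auto simp: space_PiM PiE_def extensional_def restrict_def fun_eq_iff)
      then show "?f (x(k := y)) * indicator B (restrict (x(k := y)) I) = ?f (x(k := y)) * indicator B x"
        by simp
    qed
    also have "\<dots> = (\<integral>\<^sup>+x. ?g x * indicator B x \<partial>?N I)"
    proof (intro nn_integral_cong)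
      fix x assume x: "x \<in> space (?N I)"
      have "(\<lambda>y. x(k := y)) \<in> lborel \<rightarrow>\<^sub>M ?N (insert k I)"
        using x by measurable
      then have "(\<lambda>y. ?f (x(k := y))) \<in> borel_measurable lborel"
        using distributed_borel_measurable[OF D] by (rule measurable_compose)
      then show "(\<integral>\<^sup>+y. ?f (x(k := y)) * indicator B x \<partial>lborel) = ?g x * indicator B x"
        by (subst nn_integral_multc) (simp_all only: inner)
    qed
    also have "\<dots> = emeasure (density (?N I) ?g) B"
      by (subst emeasure_density) auto
    finally show "emeasure (distr M (?N I) (joint_var X I)) B = emeasure (density (?N I) ?g) B" .
  qed simp
  then show ?thesis
    using C pos JI by (simp add: gaussian_on_def distributed_def)
qed

section \<open>Entropies of Gaussian marginals\<close>

lemma gaussian_on_empty: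
  fixes X :: "'v::finite \<Rightarrow> 'w \<Rightarrow> real"
  assumes "prob_space M" and G: "gaussian_on M X \<mu> {} A C"
  shows "C = 1"
proof -
  interpret prob_space M by fact
  interpret product_sigma_finite "\<lambda>_::'v. lborel :: real measure" by standard
  let ?N = "\<Pi>\<^sub>M i\<in>({}::'v set). (lborel :: real measure)"
  have C: "C > 0" and D: "distributed M ?N (joint_var X {})
      (\<lambda>x. ennreal (C * exp (- quad_form A {} (\<lambda>i. x i - \<mu> i) / 2)))"
    using G by (auto simp: gaussian_on_def)
  have "1 = emeasure M (joint_var X {} -` space ?N \<inter> space M)"
    using distributed_measurable[OF D] by (subst emeasure_space_1[symmetric])
      (auto intro!: arg_cong[where f="emeasure M"] dest: measurable_space)
  also have "\<dots> = (\<integral>\<^sup>+x. ennreal C * indicator (space ?N) x \<partial>?N)"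
    by (subst distributed_emeasure[OF D]) (auto simp: quad_form_def)
  also have "\<dots> = ennreal C"
    by (subst nn_integral_empty) (auto simp: space_PiM)
  finally show ?thesis using C by simp
qed

text \<open>Square integrability follows from definiteness: a variance whose integral did not exist would be
  \<open>0\<close> by the convention for integrals, but the diagonal of a positive definite matrix is positive.\<close>

lemma gaussian_family_mean_cov:
  fixes X :: "'v::finite \<Rightarrow> 'w \<Rightarrow> real"
  assumes "gaussian_family M X"
  shows gaussian_family_measurable: "X i \<in> borel_measurable M"
    and gaussian_family_integrable:
      "integrable M (\<lambda>\<omega>. (X i \<omega> - mean_vector M X $ i) * (X j \<omega> - mean_vector M X $ j))"
proof -
  have pd: "pos_definite (cov_matrix M X)" using assms by (simp add: gaussian_family_def)
  have J: "joint_var X UNIV \<in> M \<rightarrow>\<^sub>M (\<Pi>\<^sub>M i\<in>UNIV. lborel)"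
    using assms by (auto simp: gaussian_family_def dest: distributed_measurable)
  have meas[measurable]: "X i \<in> borel_measurable M" for i
  proof -
    have "(\<lambda>\<omega>. joint_var X UNIV \<omega> i) \<in> M \<rightarrow>\<^sub>M lborel"
      using measurable_component_singleton by (rule measurable_compose[OF J]) simp
    then show ?thesis by (simp add: joint_var_def)
  qed
  then show "X i \<in> borel_measurable M" .
  let ?Y = "\<lambda>i \<omega>. X i \<omega> - mean_vector M X $ i"
  have sq: "integrable M (\<lambda>\<omega>. ?Y i \<omega> * ?Y i \<omega>)" for i
  proof (rule ccontr)
    assume "\<not> ?thesis"
    then have "cov_matrix M X $ i $ i = 0"
      by (simp add: cov_matrix_def not_integrable_integral_eq)
    with pos_definite_diag_pos[OF pd, of i] show False by simp
  qed
  show "integrable M (\<lambda>\<omega>. ?Y i \<omega> * ?Y j \<omega>)"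
  proof (rule Bochner_Integration.integrable_bound[OF Bochner_Integration.integrable_add[OF sq[of i] sq[of j]]])
    have "\<bar>a * b\<bar> \<le> \<bar>a * a + b * b\<bar>" for a b :: real
    proof -
      have "0 \<le> (\<bar>a\<bar> - \<bar>b\<bar>)\<^sup>2" by simp
      then have "2 * (\<bar>a\<bar> * \<bar>b\<bar>) \<le> a * a + b * b"
        by (simp add: power2_eq_square algebra_simps)
      moreover have "0 \<le> \<bar>a\<bar> * \<bar>b\<bar>" by simp
      ultimately have "\<bar>a\<bar> * \<bar>b\<bar> \<le> a * a + b * b" by linarith
      then show ?thesis by (simp add: abs_mult)
    qed
    then show "AE \<omega> in M. norm (?Y i \<omega> * ?Y j \<omega>) \<le> norm (?Y i \<omega> * ?Y i \<omega> + ?Y j \<omega> * ?Y j \<omega>)"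
      by simp
  qed simp
qed

text \<open>The logarithm of the density is \<open>ln C\<close> minus half the quadratic form, and the quadratic form has
  expectation \<open>\<Sum>i\<in>I. \<Sum>j\<in>I. A i j * S $ i $ j = card I\<close> since \<open>A\<close> inverts the covariance matrix \<open>S\<close> on \<open>I\<close>.\<close>

lemma gaussian_on_entropy:
  fixes X :: "'v::finite \<Rightarrow> 'w \<Rightarrow> real"
  assumes F: "gaussian_family M X" and G: "gaussian_on M X (($) (mean_vector M X)) I A C"
    and A: "inverse_on I A (cov_matrix M X)"
  shows "diff_entropy M X I = real (card I) / 2 - ln C"
proof -
  interpret prob_space M using F by (simp add: gaussian_family_def)
  interpret information_space M "exp 1" by standard simp
  let ?\<mu> = "mean_vector M X" and ?S = "cov_matrix M X"
  let ?N = "\<Pi>\<^sub>M i\<in>I. (lborel :: real measure)"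
  let ?q = "\<lambda>x. quad_form A I (\<lambda>i. x i - ?\<mu> $ i)"
  let ?f = "\<lambda>x. C * exp (- ?q x / 2)"
  have C: "C > 0" and D: "distributed M ?N (joint_var X I) (\<lambda>x. ennreal (?f x))"
    using G by (auto simp: gaussian_on_def)
  have "diff_entropy M X I = - (\<integral>x. ?f x * log (exp 1) (?f x) \<partial>?N)"
    unfolding diff_entropy_def using C by (intro entropy_distr[OF D]) simp
  also have "(\<lambda>x. ?f x * log (exp 1) (?f x)) = (\<lambda>x. ?f x * (ln C - ?q x / 2))"
    using C by (simp add: log_def ln_mult)
  also have "(\<integral>x. ?f x * (ln C - ?q x / 2) \<partial>?N) = (\<integral>\<omega>. ln C - ?q (joint_var X I \<omega>) / 2 \<partial>M)"
    using C by (intro distributed_integral[OF D]) auto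
  also have "(\<lambda>\<omega>. ?q (joint_var X I \<omega>))
      = (\<lambda>\<omega>. \<Sum>i\<in>I. \<Sum>j\<in>I. A i j * ((X i \<omega> - ?\<mu> $ i) * (X j \<omega> - ?\<mu> $ j)))"
    by (auto simp: quad_form_def joint_var_def mult.assoc intro!: sum.cong)
  also have "(\<integral>\<omega>. ln C - (\<Sum>i\<in>I. \<Sum>j\<in>I. A i j * ((X i \<omega> - ?\<mu> $ i) * (X j \<omega> - ?\<mu> $ j))) / 2 \<partial>M)
      = ln C - (\<Sum>i\<in>I. \<Sum>j\<in>I. A i j * ?S $ i $ j) / 2"
    by (simp add: gaussian_family_integrable[OF F] cov_matrix_def prob_space)
  also have "(\<Sum>i\<in>I. \<Sum>j\<in>I. A i j * ?S $ i $ j) = (\<Sum>i\<in>I. \<Sum>j\<in>I. A i j * ?S $ j $ i)"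
    using F by (simp add: pos_definite_sym[of ?S] gaussian_family_def)
  also have "\<dots> = real (card I)" using A by (simp add: inverse_on_def)
  finally show ?thesis by simp
qed

lemma gaussian_family_gaussian_on_UNIV:
  fixes X :: "'v::finite \<Rightarrow> 'w \<Rightarrow> real"
  assumes F: "gaussian_family M X"
  defines "S \<equiv> cov_matrix M X"
  shows "inverse_on UNIV (\<lambda>i j. matrix_inv S $ i $ j) S"
    and "gaussian_on M X (($) (mean_vector M X)) UNIV (\<lambda>i j. matrix_inv S $ i $ j)
          (1 / sqrt ((2 * pi) ^ CARD('v) * det S))"
proof -
  have pd: "pos_definite S" using F by (simp add: gaussian_family_def S_def)
  have "(\<Sum>j\<in>UNIV. matrix_inv S $ i $ j * S $ j $ l) = (matrix_inv S ** S) $ i $ l" for i l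
    by (simp add: matrix_matrix_mult_def)
  then show "inverse_on UNIV (\<lambda>i j. matrix_inv S $ i $ j) S"
    unfolding inverse_on_def
    by (simp add: pos_definite_sym[OF pos_definite_inverse(3)[OF pd]] pos_definite_inverse(2)[OF pd] mat_def)
  have quad: "z \<bullet> (matrix_inv S *v z) = quad_form (\<lambda>i j. matrix_inv S $ i $ j) UNIV (($) z)" for z
    by (simp add: quad_form_def inner_vec_def matrix_vector_mult_def sum_distrib_left mult_ac)
  have "gaussian_density (mean_vector M X) S = (\<lambda>x. 1 / sqrt ((2 * pi) ^ CARD('v) * det S)
      * exp (- quad_form (\<lambda>i j. matrix_inv S $ i $ j) UNIV (\<lambda>i. x i - mean_vector M X $ i) / 2))"
    by (simp add: gaussian_density_def quad fun_eq_iff quad_form_def)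
  then show "gaussian_on M X (($) (mean_vector M X)) UNIV (\<lambda>i j. matrix_inv S $ i $ j)
          (1 / sqrt ((2 * pi) ^ CARD('v) * det S))"
    using F pos_definite_det_pos[OF pd] by (simp add: gaussian_on_def gaussian_family_def S_def)
qed

lemma gaussian_family_marginal:
  fixes X :: "'v::finite \<Rightarrow> 'w \<Rightarrow> real"
  assumes F: "gaussian_family M X"
  obtains A C where "inverse_on I A (cov_matrix M X)"
    "gaussian_on M X (($) (mean_vector M X)) I A C"
proof -
  have pd: "pos_definite (cov_matrix M X)" using F by (simp add: gaussian_family_def)
  have "\<exists>A C. inverse_on (UNIV - J) A (cov_matrix M X)
      \<and> gaussian_on M X (($) (mean_vector M X)) (UNIV - J) A C" for J :: "'v set"
    using finite[of J]
  proof (induction J)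
    case empty
    show ?case using gaussian_family_gaussian_on_UNIV[OF F] by auto
  next
    case (insert k J)
    then obtain A C where A: "inverse_on (UNIV - J) A (cov_matrix M X)"
      and G: "gaussian_on M X (($) (mean_vector M X)) (UNIV - J) A C" by blast
    let ?I = "UNIV - insert k J"
    have I: "UNIV - J = insert k ?I" "k \<notin> ?I" using insert.hyps by auto
    have "A k k > 0" by (rule inverse_on_diag_pos[OF pd A]) (simp add: insert.hyps)
    moreover have "A i j = A j i" for i j using A by (simp add: inverse_on_def)
    ultimately have "gaussian_on M X (($) (mean_vector M X)) ?I (eliminate k A) (C * sqrt (2 * pi / A k k))"
      using G I by (intro gaussian_on_eliminate) auto
    moreover have "inverse_on ?I (eliminate k A) (cov_matrix M X)"
      using A I \<open>A k k > 0\<close> by (intro inverse_on_eliminate) auto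
    ultimately show ?case by blast
  qed
  from this[of "UNIV - I"] that show thesis by (auto simp: double_diff)
qed

lemma gaussian_entropy_UNIV:
  fixes X :: "'v::finite \<Rightarrow> 'w \<Rightarrow> real"
  assumes F: "gaussian_family M X"
  shows "diff_entropy M X UNIV
    = real CARD('v) * ((1 + ln (2 * pi)) / 2) + ln (det (cov_matrix M X)) / 2"
proof -
  let ?S = "cov_matrix M X"
  have "det ?S > 0" using F by (intro pos_definite_det_pos) (simp add: gaussian_family_def)
  then have "ln (1 / sqrt ((2 * pi) ^ CARD('v) * det ?S))
      = - (real CARD('v) * ln (2 * pi) + ln (det ?S)) / 2"
    by (simp add: ln_div ln_sqrt ln_mult ln_realpow field_simps)
  then show ?thesis
    using gaussian_on_entropy[OF F gaussian_family_gaussian_on_UNIV(2)[OF F]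
        gaussian_family_gaussian_on_UNIV(1)[OF F]]
    by (simp add: field_simps)
qed

text \<open>Integrating out the last coordinate gives the density of a law on a one-point space, which is \<open>1\<close>.\<close>

lemma gaussian_on_singleton:
  fixes X :: "'v::finite \<Rightarrow> 'w \<Rightarrow> real"
  assumes F: "gaussian_family M X" and G: "gaussian_on M X \<mu> {i} A C"
    and A: "inverse_on {i} A (cov_matrix M X)"
  shows "ln C = - (ln (2 * pi) + ln (cov_matrix M X $ i $ i)) / 2"
proof -
  have pd: "pos_definite (cov_matrix M X)" using F by (simp add: gaussian_family_def)
  have pos: "cov_matrix M X $ i $ i > 0" "A i i > 0"
    using pos_definite_diag_pos[OF pd] inverse_on_diag_pos[OF pd A, of i] by auto
  have "A j k = A k j" for j k using A by (simp add: inverse_on_def)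
  then have "gaussian_on M X \<mu> {} (eliminate i A) (C * sqrt (2 * pi / A i i))"
    using G pos by (intro gaussian_on_eliminate) auto
  then have 1: "C * sqrt (2 * pi / A i i) = 1"
    using F gaussian_on_empty by (auto simp: gaussian_family_def)
  have "C > 0" using G by (simp add: gaussian_on_def)
  then have "ln C + (ln (2 * pi) - ln (A i i)) / 2 = ln (C * sqrt (2 * pi / A i i))"
    using pos by (simp add: ln_mult ln_sqrt ln_div)
  moreover have "A i i * cov_matrix M X $ i $ i = 1" using A by (simp add: inverse_on_def)
  then have "ln (A i i * cov_matrix M X $ i $ i) = 0" by simp
  then have "ln (A i i) + ln (cov_matrix M X $ i $ i) = 0" using pos by (simp add: ln_mult)
  ultimately show ?thesis unfolding 1 ln_one by argo
qed

lemma gaussian_entropy_singleton: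
  fixes X :: "'v::finite \<Rightarrow> 'w \<Rightarrow> real"
  assumes F: "gaussian_family M X"
  shows "diff_entropy M X {i} = (1 + ln (2 * pi)) / 2 + ln (cov_matrix M X $ i $ i) / 2"
proof -
  obtain A C where AC: "inverse_on {i} A (cov_matrix M X)"
    "gaussian_on M X (($) (mean_vector M X)) {i} A C"
    by (rule gaussian_family_marginal[OF F])
  show ?thesis
    using gaussian_on_entropy[OF F AC(2,1)] gaussian_on_singleton[OF F AC(2,1)] by (simp add: field_simps)
qed

text \<open>Integrating out \<open>i\<close> relates the constant of the pair to that of \<open>j\<close>; the pivot is
  \<open>S $ j $ j\<close> over the determinant of the covariance matrix of the pair. Positivity of the pivot also gives that of
  this determinant, which bounds the correlation strictly by \<open>1\<close>.\<close>

lemma gaussian_entropy_pair: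
  fixes X :: "'v::finite \<Rightarrow> 'w \<Rightarrow> real"
  assumes F: "gaussian_family M X" and ij: "i \<noteq> j"
  defines "S \<equiv> cov_matrix M X"
  shows "S $ i $ i * S $ j $ j - (S $ i $ j)\<^sup>2 > 0"
    and "diff_entropy M X {i, j}
      = 1 + ln (2 * pi) + ln (S $ i $ i * S $ j $ j - (S $ i $ j)\<^sup>2) / 2"
proof -
  obtain A C where A: "inverse_on {i, j} A S"
    and G: "gaussian_on M X (($) (mean_vector M X)) {i, j} A C"
    unfolding S_def by (rule gaussian_family_marginal[OF F])
  have pd: "pos_definite S" using F by (simp add: gaussian_family_def S_def)
  let ?d = "S $ i $ i * S $ j $ j - (S $ i $ j)\<^sup>2"
  have pos: "A i i > 0" "S $ j $ j > 0"
    using pos_definite_diag_pos[OF pd] inverse_on_diag_pos[OF pd A] by auto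
  have eqs: "A i i * S $ i $ i + A i j * S $ i $ j = 1" "A i i * S $ i $ j + A i j * S $ j $ j = 0"
    using A ij pos_definite_sym[OF pd, of j i] by (auto simp: inverse_on_def)
  have Ad: "A i i * ?d = S $ j $ j"
  proof -
    have "A i i * ?d = (A i i * S $ i $ i + A i j * S $ i $ j) * S $ j $ j
        - (A i i * S $ i $ j + A i j * S $ j $ j) * S $ i $ j"
      by (simp add: algebra_simps power2_eq_square)
    then show ?thesis by (simp only: eqs)
  qed
  with pos show d: "?d > 0" using zero_less_mult_pos[of "A i i" ?d] by simp
  have "A k l = A l k" for k l using A by (simp add: inverse_on_def)
  then have G': "gaussian_on M X (($) (mean_vector M X)) {j} (eliminate i A) (C * sqrt (2 * pi / A i i))"
    using G pos ij by (intro gaussian_on_eliminate) auto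
  have A': "inverse_on {j} (eliminate i A) S"
    using A ij pos by (intro inverse_on_eliminate) auto
  have "C > 0" using G by (simp add: gaussian_on_def)
  then have "ln C + (ln (2 * pi) - ln (A i i)) / 2 = ln (C * sqrt (2 * pi / A i i))"
    using pos by (simp add: ln_mult ln_sqrt ln_div)
  also have "\<dots> = - (ln (2 * pi) + ln (S $ j $ j)) / 2"
    unfolding S_def by (rule gaussian_on_singleton[OF F G' A'[unfolded S_def]])
  also have "ln (S $ j $ j) = ln (A i i) + ln ?d"
    using ln_mult_pos[OF pos(1) d] by (simp only: Ad)
  finally have "ln C = - ln (2 * pi) - ln ?d / 2" by argo
  then show "diff_entropy M X {i, j} = 1 + ln (2 * pi) + ln ?d / 2"
    using gaussian_on_entropy[OF F G A[unfolded S_def]] ij by simp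
qed

section \<open>Homogeneous fields\<close>

lemma homogeneous_moments:
  fixes X :: "'v::finite \<Rightarrow> 'w \<Rightarrow> real"
  assumes H: "homogeneous E M X" and F: "gaussian_family M X"
    and e: "{i, j} \<in> E" "{k, l} \<in> E"
  shows "cov_matrix M X $ i $ i = cov_matrix M X $ k $ k"
    and "cov_matrix M X $ i $ j = cov_matrix M X $ k $ l"
proof -
  have [measurable]: "X i \<in> borel_measurable M" for i by (rule gaussian_family_measurable[OF F])
  have int_eq: "(\<integral>\<omega>. g (X i \<omega>, X j \<omega>) \<partial>M) = (\<integral>\<omega>. g (X k \<omega>, X l \<omega>) \<partial>M)"
    if "{i, j} \<in> E" "{k, l} \<in> E" and [measurable]: "g \<in> borel_measurable (borel \<Otimes>\<^sub>M borel)"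
    for i j k l and g :: "real \<times> real \<Rightarrow> real"
  proof -
    have "(\<integral>\<omega>. g (X i \<omega>, X j \<omega>) \<partial>M) = integral\<^sup>L (distr M (borel \<Otimes>\<^sub>M borel) (\<lambda>\<omega>. (X i \<omega>, X j \<omega>))) g"
      by (subst integral_distr) auto
    also have "\<dots> = integral\<^sup>L (distr M (borel \<Otimes>\<^sub>M borel) (\<lambda>\<omega>. (X k \<omega>, X l \<omega>))) g"
      using H that(1,2) unfolding homogeneous_def by metis
    also have "\<dots> = (\<integral>\<omega>. g (X k \<omega>, X l \<omega>) \<partial>M)"
      by (subst integral_distr) auto
    finally show ?thesis .
  qed
  have e': "{j, i} \<in> E" "{l, k} \<in> E" using e by (simp_all add: insert_commute)
  have mean: "mean_vector M X $ i = mean_vector M X $ k" "mean_vector M X $ j = mean_vector M X $ l"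
    using int_eq[OF e, of fst] int_eq[OF e', of fst] by (simp_all add: mean_vector_def)
  show "cov_matrix M X $ i $ i = cov_matrix M X $ k $ k"
    using int_eq[OF e, of "\<lambda>z. (fst z - mean_vector M X $ k) * (fst z - mean_vector M X $ k)"]
    by (simp add: cov_matrix_def mean)
  show "cov_matrix M X $ i $ j = cov_matrix M X $ k $ l"
    using int_eq[OF e, of "\<lambda>z. (fst z - mean_vector M X $ k) * (snd z - mean_vector M X $ l)"]
    by (simp add: cov_matrix_def mean)
qed

text \<open>Comparing an edge with its own reversal shows that both ends have the same variance, so all vertices
  that lie on edges share one variance. Without edges any \<open>x\<close> would do, and \<open>0\<close> is chosen.\<close>

lemma homogeneous_edge_correlation:
  fixes X :: "'v::finite \<Rightarrow> 'w \<Rightarrow> real"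
  assumes E: "simple_graph E" and H: "homogeneous E M X" and F: "gaussian_family M X"
  defines "S \<equiv> cov_matrix M X"
  obtains x where "-1 < x" "x < 1"
    "\<And>i j. {i, j} \<in> E \<Longrightarrow> S $ i $ j = x * sqrt (S $ i $ i) * sqrt (S $ j $ j)"
proof (cases "E = {}")
  case True
  then show thesis using that[of 0] by simp
next
  case False
  then obtain e where "e \<in> E" by blast
  moreover from this have "card e = 2" using E by (simp add: simple_graph_def)
  ultimately obtain a b where ab: "a \<noteq> b" "{a, b} \<in> E" by (auto simp: card_2_iff)
  have "pos_definite S" using F by (simp add: gaussian_family_def S_def)
  then have pos: "S $ a $ a > 0" by (rule pos_definite_diag_pos)
  define x where "x = S $ a $ b / S $ a $ a"
  have edge: "S $ i $ i = S $ a $ a" "S $ j $ j = S $ a $ a" "S $ i $ j = S $ a $ b"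
    if "{i, j} \<in> E" for i j
  proof -
    have "{j, i} \<in> E" using that by (simp add: insert_commute)
    with that show "S $ i $ i = S $ a $ a" "S $ j $ j = S $ a $ a" "S $ i $ j = S $ a $ b"
      unfolding S_def using homogeneous_moments[OF H F _ ab(2)] by blast+
  qed
  have "(S $ a $ b)\<^sup>2 < (S $ a $ a)\<^sup>2"
    using gaussian_entropy_pair(1)[OF F ab(1)] edge(2)[OF ab(2)]
    by (simp add: S_def power2_eq_square)
  then have "\<bar>S $ a $ b\<bar> < S $ a $ a" 
    using pos power2_less_imp_less[of "\<bar>S $ a $ b\<bar>" "S $ a $ a"] by simp
  then have "-1 < x" "x < 1" using pos by (simp_all add: x_def field_simps abs_less_iff)
  moreover have "S $ i $ j = x * sqrt (S $ i $ i) * sqrt (S $ j $ j)" if "{i, j} \<in> E" for i j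
    using pos by (simp add: edge[OF that] x_def mult.assoc)
  ultimately show thesis by (rule that)
qed

lemma sum_edges_eq_sum_degree:
  "(\<Sum>e\<in>E. \<Sum>v\<in>e. f v) = (\<Sum>v\<in>UNIV. real (vertex_degree E v) * f v)"
proof -
  have "(\<Sum>e\<in>E. \<Sum>v\<in>e. f v) = (\<Sum>e\<in>E. \<Sum>v\<in>UNIV. if v \<in> e then f v else 0)"
    by (simp add: sum.If_cases)
  also have "\<dots> = (\<Sum>v\<in>UNIV. \<Sum>e\<in>E. if v \<in> e then f v else 0)"
    by (rule sum.swap)
  also have "\<dots> = (\<Sum>v\<in>UNIV. real (vertex_degree E v) * f v)"
    by (simp add: sum.If_cases vertex_degree_def Int_def)
  finally show ?thesis .
qed

theorem mainTheorem3:
  fixes E :: "'v::finite set set"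
    and M :: "'w measure"
    and X :: "'v \<Rightarrow> 'w \<Rightarrow> real"
  assumes "simple_graph E"
    and "bipartite E"
    and "\<And>x. -1 < x \<Longrightarrow> x < 1 \<Longrightarrow> tau E x \<ge> (1 - x\<^sup>2) ^ card E"
    and "GMRF E M X"
    and "homogeneous E M X"
  shows "diff_entropy M X UNIV - (\<Sum>e\<in>E. diff_entropy M X e)
           + (\<Sum>v\<in>UNIV. (real (vertex_degree E v) - 1) * diff_entropy M X {v}) \<ge> 0"
proof -
  define S where "S = cov_matrix M X"
  define h where "h v = diff_entropy M X {v}" for v
  have F: "gaussian_family M X"
    and markov: "\<And>i j. i \<noteq> j \<Longrightarrow> {i, j} \<notin> E \<Longrightarrow> matrix_inv S $ i $ j = 0"
    using assms(4) by (auto simp: GMRF_def S_def)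
  have pd: "pos_definite S" using F by (simp add: gaussian_family_def S_def)
  have diag: "S $ i $ i > 0" for i by (rule pos_definite_diag_pos[OF pd])
  obtain x where x: "-1 < x" "x < 1"
    and edge: "\<And>i j. {i, j} \<in> E \<Longrightarrow> S $ i $ j = x * sqrt (S $ i $ i) * sqrt (S $ j $ j)"
    unfolding S_def by (rule homogeneous_edge_correlation[OF assms(1,5) F]) blast
  have x2: "1 - x\<^sup>2 > 0" using x by (simp add: abs_square_less_1)
  have h: "h v = (1 + ln (2 * pi)) / 2 + ln (S $ v $ v) / 2" for v
    by (simp add: h_def S_def gaussian_entropy_singleton[OF F])
  (* The covariance matrix of the pair has determinant S_ii * S_jj * (1 - x^2), where 1 - x^2
     is the only deviation from independent ends. *)
  have "diff_entropy M X e = (\<Sum>v\<in>e. h v) + ln (1 - x\<^sup>2) / 2" if "e \<in> E" for e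
  proof -
    have "card e = 2" using assms(1) that by (simp add: simple_graph_def)
    then obtain i j where e: "e = {i, j}" "i \<noteq> j" by (auto simp: card_2_iff)
    have "S $ i $ i * S $ j $ j - (S $ i $ j)\<^sup>2 = S $ i $ i * S $ j $ j * (1 - x\<^sup>2)"
      using edge[of i j] that diag[of i] diag[of j]
      by (simp add: e power_mult_distrib algebra_simps)
    then have "ln (S $ i $ i * S $ j $ j - (S $ i $ j)\<^sup>2) = ln (S $ i $ i) + ln (S $ j $ j) + ln (1 - x\<^sup>2)"
      using diag[of i] diag[of j] x2 by (simp add: ln_mult)
    with gaussian_entropy_pair(2)[OF F e(2)] show ?thesis
      using e(2) by (simp add: e(1) h S_def field_simps)
  qed
  then have "(\<Sum>e\<in>E. diff_entropy M X e)
      = (\<Sum>v\<in>UNIV. real (vertex_degree E v) * h v) + real (card E) * (ln (1 - x\<^sup>2) / 2)"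
    by (simp add: sum.distrib flip: sum_edges_eq_sum_degree)
  moreover have "(\<Sum>v\<in>UNIV. (real (vertex_degree E v) - 1) * h v)
      = (\<Sum>v\<in>UNIV. real (vertex_degree E v) * h v) - (\<Sum>v\<in>UNIV. h v)"
    by (simp add: left_diff_distrib sum_subtractf)
  (* The terms 1 + ln (2 * pi) cancel: both sides have n coordinates. *)
  moreover have "diff_entropy M X UNIV - (\<Sum>v\<in>UNIV. h v)
      = (ln (det S) - (\<Sum>v\<in>UNIV. ln (S $ v $ v))) / 2"
    by (simp add: gaussian_entropy_UNIV[OF F] S_def[symmetric] h sum.distrib diff_divide_distrib
        flip: sum_divide_distrib)
  moreover have "real (card E) * ln (1 - x\<^sup>2) + (\<Sum>v\<in>UNIV. ln (S $ v $ v)) \<le> ln (det S)"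
  proof -
    have prod: "(\<Prod>v\<in>UNIV. S $ v $ v) > 0" by (intro prod_pos) (simp add: diag)
    have "tau E x * (\<Prod>v\<in>UNIV. S $ v $ v) = det S"
      using tau_eq_det[OF pd markov edge] by blast
    then have "(1 - x\<^sup>2) ^ card E * (\<Prod>v\<in>UNIV. S $ v $ v) \<le> det S"
      using mult_right_mono[OF assms(3)[OF x] less_imp_le[OF prod]] by simp
    then have "ln ((1 - x\<^sup>2) ^ card E * (\<Prod>v\<in>UNIV. S $ v $ v)) \<le> ln (det S)"
      using x2 prod by (intro ln_mono mult_pos_pos) auto
    moreover have "ln (\<Prod>v\<in>UNIV. S $ v $ v) = (\<Sum>v\<in>UNIV. ln (S $ v $ v))"
      using diag by (intro ln_prod) (auto simp: less_imp_neq[symmetric])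
    ultimately show ?thesis
      using x2 ln_mult_pos[OF zero_less_power[OF x2] prod] by (simp add: ln_realpow)
  qed
  ultimately show ?thesis
    unfolding h_def[symmetric] by (simp add: field_simps)
qed

end
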